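(* Let $\mathbb A$ be the Siggers digraph. For every $n\ge1$, every quantum polymorphism $Q:\mathbb A^n\to_q\mathbb A$ is non-contextual.
   Context: The Siggers digraph is the digraph with vertex set $A=\{0,1,2\}$ and edge set $\{(0,1),(1,2),(2,0),(0,2)\}$. Its $n$-th power $\mathbb A^n$ has vertex set $A^n$ and an edge from $\mathbf x$ to $\mathbf y$ iff $(x_i,y_i)$ is an edge of $\mathbb A$ for every $i\in[n]$. A quantum homomorphism $Q:\mathbb X\to_q\mathbb A$ between finite digraphs consists of a non-trivial finite-dimensional Hilbert space $H$ and, for each vertex $x$ of $\mathbb X$, a PVM $(Q_{x,a})_{a\in A}$ on $H$ (i.e., operators with $Q_{x,a}=Q_{x,a}^*=Q_{x,a}^2$ and $\sum_{a\in A}Q_{x,a}=\mathrm{id}$) such that, for all edges $(x,y)$ of $\mathbb X$: $Q_{x,a}Q_{y,b}=0$ whenever $(a,b)$ is not an edge of $\mathbb A$, and $Q_{x,a}Q_{y,b}=Q_{y,b}Q_{x,a}$ for all $a,b\in A$. $Q$ is non-contextual if $Q_{x,a}Q_{y,b}=Q_{y,b}Q_{x,a}$ for all vertices $x,y$ of $\mathbb X$ and all $a,b\in A$. *)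

theory Defs
  imports Complex_Main "HOL-Library.FuncSet" "Graph_Theory.Pair_Digraph"
begin

definition siggers_digraph :: "nat pair_pre_digraph" where
  "siggers_digraph = \<lparr>pverts = {0, 1, 2}, parcs = {(0, 1), (1, 2), (2, 0), (0, 2)}\<rparr>"

(* An n-tuple is a function on {1..n}, extended by undefined elsewhere. *)
definition digraph_power :: "nat \<Rightarrow> 'a pair_pre_digraph \<Rightarrow> (nat \<Rightarrow> 'a) pair_pre_digraph" where
  "digraph_power n G =
    \<lparr>pverts = {1..n} \<rightarrow>\<^sub>E pverts G,
     parcs = {(x, y). x \<in> {1..n} \<rightarrow>\<^sub>E pverts G \<and> y \<in> {1..n} \<rightarrow>\<^sub>E pverts G \<and>
                      (\<forall>i\<in>{1..n}. (x i, y i) \<in> parcs G)}\<rparr>"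

lemma pair_fin_digraph_siggers: "pair_fin_digraph siggers_digraph"
  by unfold_locales (auto simp: siggers_digraph_def)

lemma pair_fin_digraph_power:
  assumes "pair_fin_digraph G"
  shows "pair_fin_digraph (digraph_power n G)"
proof -
  have fin: "finite ({1..n} \<rightarrow>\<^sub>E pverts G)"
    using assms by (intro finite_PiE) (auto simp: pair_fin_digraph_def pair_fin_digraph_axioms_def)
  moreover have "finite (parcs (digraph_power n G))"
    by (rule finite_subset[OF _ finite_cartesian_product[OF fin fin]])
      (auto simp: digraph_power_def)
  ultimately show ?thesis
    by unfold_locales (auto simp: digraph_power_def)
qed

(* The inner product is linear in the first argument. Completeness is not listed
   because it is automatic in finite dimension. *)
locale finite_dim_hilbert_space = vector_space scale
  for scale :: "complex \<Rightarrow> 'h::ab_group_add \<Rightarrow> 'h" +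
  fixes ip :: "'h \<Rightarrow> 'h \<Rightarrow> complex"
  assumes finite_dim: "\<exists>B. finite_dimensional_vector_space scale B"
    and ip_add_left: "ip (u + v) w = ip u w + ip v w"
    and ip_scale_left: "ip (scale c u) v = c * ip u v"
    and ip_cnj: "ip u v = cnj (ip v u)"
    and ip_pos: "u \<noteq> 0 \<Longrightarrow> Re (ip u u) > 0"

definition is_adjoint :: "('h \<Rightarrow> 'h \<Rightarrow> complex) \<Rightarrow> ('h \<Rightarrow> 'h) \<Rightarrow> ('h \<Rightarrow> 'h) \<Rightarrow> bool" where
  "is_adjoint ip S T \<longleftrightarrow> (\<forall>u v. ip (T u) v = ip u (S v))"

definition pvm ::
  "(complex \<Rightarrow> 'h::ab_group_add \<Rightarrow> 'h) \<Rightarrow> ('h \<Rightarrow> 'h \<Rightarrow> complex) \<Rightarrow> 'a set \<Rightarrow> ('a \<Rightarrow> 'h \<Rightarrow> 'h) \<Rightarrow> bool"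
where
  "pvm scale ip A P \<longleftrightarrow>
    (\<forall>a\<in>A. Vector_Spaces.linear scale scale (P a) \<and> is_adjoint ip (P a) (P a) \<and> P a \<circ> P a = P a) \<and>
    (\<forall>v. (\<Sum>a\<in>A. P a v) = v)"

definition quantum_homomorphism ::
  "(complex \<Rightarrow> 'h::ab_group_add \<Rightarrow> 'h) \<Rightarrow> ('h \<Rightarrow> 'h \<Rightarrow> complex) \<Rightarrow>
   'v pair_pre_digraph \<Rightarrow> 'a pair_pre_digraph \<Rightarrow> ('v \<Rightarrow> 'a \<Rightarrow> 'h \<Rightarrow> 'h) \<Rightarrow> bool"
where
  "quantum_homomorphism scale ip X A Q \<longleftrightarrow>
    pair_fin_digraph X \<and> pair_fin_digraph A \<and>
    finite_dim_hilbert_space scale ip \<and> (\<exists>v::'h. v \<noteq> 0) \<and>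
    (\<forall>x\<in>pverts X. pvm scale ip (pverts A) (Q x)) \<and>
    (\<forall>(x, y)\<in>parcs X. \<forall>a\<in>pverts A. \<forall>b\<in>pverts A.
      ((a, b) \<notin> parcs A \<longrightarrow> Q x a \<circ> Q y b = (\<lambda>v. 0)) \<and>
      Q x a \<circ> Q y b = Q y b \<circ> Q x a)"

definition quantum_polymorphism ::
  "(complex \<Rightarrow> 'h::ab_group_add \<Rightarrow> 'h) \<Rightarrow> ('h \<Rightarrow> 'h \<Rightarrow> complex) \<Rightarrow>
   nat \<Rightarrow> 'a pair_pre_digraph \<Rightarrow> ((nat \<Rightarrow> 'a) \<Rightarrow> 'a \<Rightarrow> 'h \<Rightarrow> 'h) \<Rightarrow> bool"
where
  "quantum_polymorphism scale ip n A Q \<longleftrightarrow> quantum_homomorphism scale ip (digraph_power n A) A Q"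

definition non_contextual ::
  "'v pair_pre_digraph \<Rightarrow> 'a pair_pre_digraph \<Rightarrow> ('v \<Rightarrow> 'a \<Rightarrow> 'h \<Rightarrow> 'h) \<Rightarrow> bool"
where
  "non_contextual X A Q \<longleftrightarrow>
    (\<forall>x\<in>pverts X. \<forall>y\<in>pverts X. \<forall>a\<in>pverts A. \<forall>b\<in>pverts A.
      Q x a \<circ> Q y b = Q y b \<circ> Q x a)"

end

theory Submission
  imports Defs
begin

text \<open>
  An edge \<open>x \<rightarrow> y\<close> of the power forces \<open>Q\<^bsub>x,2\<^esub> = Q\<^bsub>y,0\<^esub>\<close>, because \<open>(2,0)\<close> is both the only edge
  of the Siggers digraph leaving 2 and the only one entering 0. Walking along such edges shows that
  \<open>Q\<^bsub>x,0\<^esub>\<close> and \<open>Q\<^bsub>x,2\<^esub>\<close> are the values, at the index sets where \<open>x\<close> is 0 respectively 2, of a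
  single family of projections indexed by subsets of \<open>[n]\<close>. For any two subsets \<open>S\<close> and \<open>T\<close> there
  is an edge \<open>x \<rightarrow> y\<close> such that \<open>x\<close> is 0 exactly on \<open>S\<close> and \<open>y\<close> is 2 exactly on \<open>T\<close>, so any two
  members of the family commute; the remaining projections are \<open>Q\<^bsub>x,1\<^esub> = id - Q\<^bsub>x,0\<^esub> - Q\<^bsub>x,2\<^esub>\<close>.
\<close>

text \<open>Serves to carry commutation over from outcomes 0 and 2 to outcome 1.\<close>

lemma linear_comp_diff_commute:
  assumes "Vector_Spaces.linear scale scale F"
    and "F \<circ> A = A \<circ> F" "F \<circ> B = B \<circ> F"
    and C: "\<And>v. C v = v - A v - B v"
  shows "F \<circ> C = C \<circ> F"
proof
  fix v
  interpret F: Vector_Spaces.linear scale scale F by fact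
  have "F (A v) = A (F v)" "F (B v) = B (F v)"
    using assms(2,3) by (simp_all add: fun_eq_iff)
  then show "(F \<circ> C) v = (C \<circ> F) v"
    by (simp add: C F.diff)
qed

lemma pverts_siggers: "pverts siggers_digraph = {0, 1, 2}"
  by (simp add: siggers_digraph_def)

lemma pverts_siggers_power:
  "pverts (digraph_power n siggers_digraph) = {1..n} \<rightarrow>\<^sub>E {0, 1, 2}"
  by (simp add: digraph_power_def pverts_siggers)

context
  fixes scale :: "complex \<Rightarrow> 'h::ab_group_add \<Rightarrow> 'h"
    and ip :: "'h \<Rightarrow> 'h \<Rightarrow> complex"
    and n :: nat
    and Q :: "(nat \<Rightarrow> nat) \<Rightarrow> nat \<Rightarrow> 'h \<Rightarrow> 'h"
  assumes poly: "quantum_polymorphism scale ip n siggers_digraph Q"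
begin

lemma siggers_polymorphism_pvm:
  assumes "x \<in> {1..n} \<rightarrow>\<^sub>E {0, 1, 2}"
  shows "pvm scale ip {0, 1, 2} (Q x)"
  using poly assms
  unfolding quantum_polymorphism_def quantum_homomorphism_def pverts_siggers_power pverts_siggers
  by blast

lemma siggers_polymorphism_linear:
  assumes "x \<in> {1..n} \<rightarrow>\<^sub>E {0, 1, 2}" "a \<in> {0, 1, 2}"
  shows "Vector_Spaces.linear scale scale (Q x a)"
  using siggers_polymorphism_pvm[OF assms(1)] assms(2) unfolding pvm_def by blast

lemma siggers_polymorphism_sum:
  assumes "x \<in> {1..n} \<rightarrow>\<^sub>E {0, 1, 2}"
  shows "Q x 0 v + Q x 1 v + Q x 2 v = v"
  using siggers_polymorphism_pvm[OF assms] unfolding pvm_def by (simp add: add.assoc)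

lemma siggers_polymorphism_edge:
  assumes "(x, y) \<in> parcs (digraph_power n siggers_digraph)" "a \<in> {0, 1, 2}" "b \<in> {0, 1, 2}"
  shows "(a, b) \<notin> parcs siggers_digraph \<Longrightarrow> Q x a (Q y b v) = 0"
    and "Q x a (Q y b v) = Q y b (Q x a v)"
proof -
  have "((a, b) \<notin> parcs siggers_digraph \<longrightarrow> Q x a \<circ> Q y b = (\<lambda>v. 0)) \<and>
      Q x a \<circ> Q y b = Q y b \<circ> Q x a"
    using poly assms
    unfolding quantum_polymorphism_def quantum_homomorphism_def pverts_siggers by blast
  then show "(a, b) \<notin> parcs siggers_digraph \<Longrightarrow> Q x a (Q y b v) = 0"
    and "Q x a (Q y b v) = Q y b (Q x a v)"
    by (simp_all add: fun_eq_iff)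
qed

text \<open>Both sides equal \<open>Q x 2 \<circ> Q y 0\<close>: expand the identity over the
  outcomes at \<open>y\<close> on the one side and at \<open>x\<close> on the other, and only this
  product survives.\<close>

lemma siggers_polymorphism_edge_eq:
  assumes edge: "(x, y) \<in> parcs (digraph_power n siggers_digraph)"
  shows "Q x 2 = Q y 0"
proof
  fix v
  have x: "x \<in> {1..n} \<rightarrow>\<^sub>E {0, 1, 2}" and y: "y \<in> {1..n} \<rightarrow>\<^sub>E {0, 1, 2}"
    using edge by (auto simp: digraph_power_def siggers_digraph_def)
  interpret Qx2: Vector_Spaces.linear scale scale "Q x 2"
    by (rule siggers_polymorphism_linear) (use x in auto)
  have zero: "Q x 2 (Q y 1 v) = 0" "Q x 2 (Q y 2 v) = 0"
      "Q x 0 (Q y 0 v) = 0" "Q x 1 (Q y 0 v) = 0"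
    using siggers_polymorphism_edge(1)[OF edge] by (auto simp: siggers_digraph_def)
  have "Q x 2 v = Q x 2 (Q y 0 v + Q y 1 v + Q y 2 v)"
    by (simp only: siggers_polymorphism_sum[OF y])
  also have "\<dots> = Q x 2 (Q y 0 v)"
    by (simp only: Qx2.add zero add_0_right)
  also have "\<dots> = Q x 0 (Q y 0 v) + Q x 1 (Q y 0 v) + Q x 2 (Q y 0 v)"
    by (simp only: zero add_0_left)
  also have "\<dots> = Q y 0 v"
    by (rule siggers_polymorphism_sum[OF x])
  finally show "Q x 2 v = Q y 0 v" .
qed

lemma siggers_polymorphism_zeros:
  assumes u: "u \<in> {1..n} \<rightarrow>\<^sub>E {0, 1, 2}" and w: "w \<in> {1..n} \<rightarrow>\<^sub>E {0, 1, 2}"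
    and same: "\<And>i. i \<in> {1..n} \<Longrightarrow> u i = 0 \<longleftrightarrow> w i = 0"
  shows "Q u 0 = Q w 0"
proof -
  \<comment> \<open>A common in-neighbour of \<open>u\<close> and \<open>w\<close>: 0 can only be
    entered from 2, while 0 has edges to both 1 and 2. Then \<open>Q z 2\<close> equals both
    sides.\<close>
  define z where "z = (\<lambda>i\<in>{1..n}. if u i = 0 then 2 else 0::nat)"
  have "(z, u) \<in> parcs (digraph_power n siggers_digraph)"
    using u unfolding z_def digraph_power_def siggers_digraph_def
    by (auto simp: PiE_iff extensional_def)
  moreover have "(z, w) \<in> parcs (digraph_power n siggers_digraph)"
    using w same unfolding z_def digraph_power_def siggers_digraph_def
    by (auto simp: PiE_iff extensional_def)
  ultimately show ?thesis
    by (metis siggers_polymorphism_edge_eq)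
qed

lemma siggers_polymorphism_zeros_twos:
  assumes u: "u \<in> {1..n} \<rightarrow>\<^sub>E {0, 1, 2}" and w: "w \<in> {1..n} \<rightarrow>\<^sub>E {0, 1, 2}"
    and same: "\<And>i. i \<in> {1..n} \<Longrightarrow> u i = 2 \<longleftrightarrow> w i = 0"
  shows "Q u 2 = Q w 0"
proof -
  \<comment> \<open>An out-neighbour of \<open>u\<close> whose zeros are the twos of
    \<open>u\<close>: 2 only leads to 0, while 0 and 1 both lead to 2.\<close>
  define z where "z = (\<lambda>i\<in>{1..n}. if u i = 2 then 0 else 2::nat)"
  have "(u, z) \<in> parcs (digraph_power n siggers_digraph)"
    using u unfolding z_def digraph_power_def siggers_digraph_def
    by (auto simp: PiE_iff extensional_def)
  then have "Q u 2 = Q z 0"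
    by (rule siggers_polymorphism_edge_eq)
  also have "\<dots> = Q w 0"
    using w same by (intro siggers_polymorphism_zeros) (auto simp: z_def)
  finally show ?thesis .
qed

lemma siggers_polymorphism_zeros_commute:
  assumes u: "u \<in> {1..n} \<rightarrow>\<^sub>E {0, 1, 2}" and w: "w \<in> {1..n} \<rightarrow>\<^sub>E {0, 1, 2}"
  shows "Q u 0 \<circ> Q w 0 = Q w 0 \<circ> Q u 0"
proof -
  \<comment> \<open>At each index the four truth values of \<open>u i = 0\<close> and
    \<open>w i = 0\<close> select the four edges: (0,2) if both hold, (0,1) if only the first, (1,2)
    if only the second, (2,0) if neither.\<close>
  define x where "x = (\<lambda>i\<in>{1..n}. if u i = 0 then 0 else if w i = 0 then 1 else 2::nat)"
  define y where "y = (\<lambda>i\<in>{1..n}. if w i = 0 then 2 else if u i = 0 then 1 else 0::nat)"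
  have edge: "(x, y) \<in> parcs (digraph_power n siggers_digraph)"
    unfolding x_def y_def digraph_power_def siggers_digraph_def by auto
  have x: "x \<in> {1..n} \<rightarrow>\<^sub>E {0, 1, 2}" and y: "y \<in> {1..n} \<rightarrow>\<^sub>E {0, 1, 2}"
    by (auto simp: x_def y_def)
  have "Q u 0 = Q x 0"
    using u x by (rule siggers_polymorphism_zeros) (auto simp: x_def)
  moreover have "Q y 2 = Q w 0"
    using y w by (rule siggers_polymorphism_zeros_twos) (auto simp: y_def)
  ultimately show ?thesis
    using siggers_polymorphism_edge(2)[OF edge, of 0 2] by (simp add: fun_eq_iff)
qed

lemma siggers_polymorphism_eq_zeros:
  assumes "u \<in> {1..n} \<rightarrow>\<^sub>E {0, 1, 2}" "a \<in> {0, 2}"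
  shows "\<exists>w \<in> {1..n} \<rightarrow>\<^sub>E {0, 1, 2}. Q u a = Q w 0"
proof (cases "a = 0")
  case False
  \<comment> \<open>Only the zero set matters; any nonzero value would do in place of 2.\<close>
  let ?w = "\<lambda>i\<in>{1..n}. if u i = 2 then 0 else 2::nat"
  have "?w \<in> {1..n} \<rightarrow>\<^sub>E {0, 1, 2}" by auto
  moreover from this have "Q u 2 = Q ?w 0"
    using assms(1) by (intro siggers_polymorphism_zeros_twos) auto
  ultimately show ?thesis using assms(2) False by blast
qed (use assms in blast)

lemma siggers_polymorphism_commute:
  assumes x: "x \<in> {1..n} \<rightarrow>\<^sub>E {0, 1, 2}" and y: "y \<in> {1..n} \<rightarrow>\<^sub>E {0, 1, 2}"
    and a: "a \<in> {0, 1, 2}" and b: "b \<in> {0, 1, 2}"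
  shows "Q x a \<circ> Q y b = Q y b \<circ> Q x a"
proof -
  have one: "Q z 1 v = v - Q z 0 v - Q z 2 v" if "z \<in> {1..n} \<rightarrow>\<^sub>E {0, 1, 2}" for z v
    using siggers_polymorphism_sum[OF that, of v] by (simp add: algebra_simps)
  have outer: "Q x a' \<circ> Q y b' = Q y b' \<circ> Q x a'" if "a' \<in> {0, 2}" "b' \<in> {0, 2}" for a' b'
    using siggers_polymorphism_eq_zeros[OF x that(1)] siggers_polymorphism_eq_zeros[OF y that(2)]
      siggers_polymorphism_zeros_commute by metis
  \<comment> \<open>Outcome 1 is eliminated first at \<open>y\<close>, with the outcome at
    \<open>x\<close> still in {0, 2}, and only then at \<open>x\<close>.\<close>
  have left: "Q x a' \<circ> Q y b = Q y b \<circ> Q x a'" if a': "a' \<in> {0, 2}" for a'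
  proof (cases "b = 1")
    case True
    show ?thesis
      unfolding True
      by (rule linear_comp_diff_commute[OF siggers_polymorphism_linear outer outer])
        (use x a' one[OF y] in auto)
  next
    case False
    with b a' show ?thesis by (intro outer) auto
  qed
  show ?thesis
  proof (cases "a = 1")
    case True
    have "Q y b \<circ> Q x 1 = Q x 1 \<circ> Q y b"
      by (rule linear_comp_diff_commute[OF siggers_polymorphism_linear[OF y b]
            left[symmetric] left[symmetric]])
        (use one[OF x] in auto)
    with True show ?thesis by simp
  next
    case False
    with a show ?thesis by (intro left) auto
  qed
qed

end

theorem theorem72:
  fixes scale :: "complex \<Rightarrow> 'h::ab_group_add \<Rightarrow> 'h"
    and ip :: "'h \<Rightarrow> 'h \<Rightarrow> complex"
    and n :: nat
    and Q :: "(nat \<Rightarrow> nat) \<Rightarrow> nat \<Rightarrow> 'h \<Rightarrow> 'h"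
  assumes "n \<ge> 1"
    and "quantum_polymorphism scale ip n siggers_digraph Q"
  shows "non_contextual (digraph_power n siggers_digraph) siggers_digraph Q"
  unfolding non_contextual_def pverts_siggers_power pverts_siggers
  using siggers_polymorphism_commute[OF assms(2)] by blast

end
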